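(* Let $(\mathbf{X},d)$ be a complete length space, let $\Omega\subsetneq\mathbf{X}$ be a bounded domain, and let $f$ be a positive Borel measurable function on $\overline\Omega$ with $\inf_\Omega f>0$, such that $\Gamma_f(x,y)\ne\emptyset$ for all $x,y\in\overline\Omega$. Assume that $(\overline{\Omega},L_f)$ is compact. Let $u\in USC_L(\overline{\Omega})$ and $v\in LSC_L(\overline{\Omega})$ be respectively a bounded Monge subsolution and a bounded Monge supersolution of $|\nabla u|=f$ in $\Omega$. If $u\le v$ on $\partial\Omega$, then $u\le v$ in $\overline{\Omega}$.
   Context: For $x,y\in\overline{\Omega}$, $\Gamma_f(x,y)$ is the set of rectifiable curves $\gamma:[0,\ell]\to\overline{\Omega}$, parametrized by arc length, with $\gamma(0)=x$, $\gamma(\ell)=y$ and $\int_\gamma f\,ds<\infty$ (the constant curve is allowed when $x=y$), and $L_f(x,y):=\inf\{\int_\gamma f\,ds:\gamma\in\Gamma_f(x,y)\}$. $u\in USC_L(\overline{\Omega})$ (resp. $LSC_L(\overline\Omega)$) means that $u:\overline\Omega\to\mathbb{R}$ is upper (resp. lower) semicontinuous with respect to $L_f$: for every $x\in\overline{\Omega}$, $\limsup_{y\in\overline\Omega,\ L_f(x,y)\to0}u(y)\le u(x)$ (resp. $\liminf_{y\in\overline\Omega,\ L_f(x,y)\to0}u(y)\ge u(x)$). A function $u$ on $\Omega$, locally bounded with respect to the topology induced by $L_f$, is a Monge subsolution (resp. supersolution) of $|\nabla u|=f$ in $\Omega$ if for every $x_0\in\Omega$, $\limsup_{L_f(x,x_0)\to0}\frac{u(x_0)-u(x)}{L_f(x_0,x)}\le1$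 (resp. $\ge1$). Closure and boundary of $\Omega$ are taken with respect to $d$. *)

theory Defs
  imports "HOL-Analysis.Analysis"
begin

definition curve_length :: "(real \<Rightarrow> 'a::metric_space) \<Rightarrow> real \<Rightarrow> real \<Rightarrow> ennreal" where
  "curve_length \<gamma> a b =
     (SUP ts \<in> {ts. sorted ts \<and> set ts \<subseteq> {a..b}}.
        \<Sum>i<length ts - 1. ennreal (dist (\<gamma> (ts ! i)) (\<gamma> (ts ! Suc i))))"

text \<open>The space is the whole type. The infimum is taken in the extended nonnegative reals, so
  points that no rectifiable path joins would be at infinite distance: in a length space any two
  points are joined by a rectifiable path.\<close>

definition length_space :: "'a::metric_space itself \<Rightarrow> bool" where
  "length_space _ \<longleftrightarrow>
     (\<forall>x y :: 'a. ennreal (dist x y) =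
        (INF \<gamma> \<in> {\<gamma>. path \<gamma> \<and> pathstart \<gamma> = x \<and> pathfinish \<gamma> = y}. curve_length \<gamma> 0 1))"

text \<open>A curve is a pair of its length \<open>l\<close> and a map \<open>\<gamma>\<close> of which only the values on \<open>{0..l}\<close>
  matter. The unit-speed condition makes it rectifiable, and for \<open>l = 0\<close> it is a constant curve.\<close>

definition arclength_curve :: "real \<Rightarrow> (real \<Rightarrow> 'a::metric_space) \<Rightarrow> bool" where
  "arclength_curve l \<gamma> \<longleftrightarrow>
     0 \<le> l \<and> continuous_on {0..l} \<gamma> \<and>
     (\<forall>s t. 0 \<le> s \<and> s \<le> t \<and> t \<le> l \<longrightarrow> curve_length \<gamma> s t = ennreal (t - s))"

definition curve_integral :: "('a \<Rightarrow> real) \<Rightarrow> real \<Rightarrow> (real \<Rightarrow> 'a) \<Rightarrow> ennreal" where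
  "curve_integral f l \<gamma> = (\<integral>\<^sup>+t\<in>{0..l}. ennreal (f (\<gamma> t)) \<partial>lborel)"

definition Gamma_f ::
  "'a::metric_space set \<Rightarrow> ('a \<Rightarrow> real) \<Rightarrow> 'a \<Rightarrow> 'a \<Rightarrow> (real \<times> (real \<Rightarrow> 'a)) set" where
  "Gamma_f \<Omega> f x y =
     {(l, \<gamma>). arclength_curve l \<gamma> \<and> \<gamma> ` {0..l} \<subseteq> closure \<Omega> \<and> \<gamma> 0 = x \<and> \<gamma> l = y \<and>
              curve_integral f l \<gamma> < \<infinity>}"

text \<open>The infimum is finite, and the conversion to a real faithful, whenever
  \<open>Gamma_f \<Omega> f x y \<noteq> {}\<close>; otherwise the value is a meaningless \<open>0\<close>.\<close>

definition L_f :: "'a::metric_space set \<Rightarrow> ('a \<Rightarrow> real) \<Rightarrow> 'a \<Rightarrow> 'a \<Rightarrow> real" where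
  "L_f \<Omega> f x y = enn2real (INF (l, \<gamma>) \<in> Gamma_f \<Omega> f x y. curve_integral f l \<gamma>)"

text \<open>The topology on \<open>closure \<Omega>\<close> induced by \<open>L_f\<close>, defined as \<open>mtopology\<close> is for a metric: a
  set is open iff it contains a ball around each of its points. The locale \<open>Metric_space\<close> is not
  used because \<open>L_f\<close> may vanish between distinct boundary points when \<open>f\<close> is bounded away from
  \<open>0\<close> only on \<open>\<Omega>\<close>.\<close>

definition L_topology :: "'a::metric_space set \<Rightarrow> ('a \<Rightarrow> real) \<Rightarrow> 'a topology" where
  "L_topology \<Omega> f = topology (\<lambda>U. U \<subseteq> closure \<Omega> \<and>
     (\<forall>x\<in>U. \<exists>r>0. {y \<in> closure \<Omega>. L_f \<Omega> f x y < r} \<subseteq> U))"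

lemma openin_L_topology:
  "openin (L_topology \<Omega> f) U \<longleftrightarrow>
     U \<subseteq> closure \<Omega> \<and> (\<forall>x\<in>U. \<exists>r>0. {y \<in> closure \<Omega>. L_f \<Omega> f x y < r} \<subseteq> U)"
proof -
  let ?P = "\<lambda>U. U \<subseteq> closure \<Omega> \<and> (\<forall>x\<in>U. \<exists>r>0. {y \<in> closure \<Omega>. L_f \<Omega> f x y < r} \<subseteq> U)"
  have "?P (S \<inter> T)" if S: "?P S" and T: "?P T" for S T
  proof (intro conjI ballI)
    show "S \<inter> T \<subseteq> closure \<Omega>" using S by blast
    fix x assume x: "x \<in> S \<inter> T"
    obtain r where r: "r > 0" "{y \<in> closure \<Omega>. L_f \<Omega> f x y < r} \<subseteq> S" using S x by blast
    obtain q where q: "q > 0" "{y \<in> closure \<Omega>. L_f \<Omega> f x y < q} \<subseteq> T" using T x by blast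
    have "min r q > 0 \<and> {y \<in> closure \<Omega>. L_f \<Omega> f x y < min r q} \<subseteq> S \<inter> T"
      using r q by auto
    then show "\<exists>r>0. {y \<in> closure \<Omega>. L_f \<Omega> f x y < r} \<subseteq> S \<inter> T" by blast
  qed
  moreover have "?P (\<Union>\<K>)" if K: "\<forall>U\<in>\<K>. ?P U" for \<K>
  proof (intro conjI ballI)
    show "\<Union>\<K> \<subseteq> closure \<Omega>" using K by blast
    fix x assume "x \<in> \<Union>\<K>"
    then obtain U where U: "U \<in> \<K>" "x \<in> U" by blast
    with K obtain r where "r > 0" "{y \<in> closure \<Omega>. L_f \<Omega> f x y < r} \<subseteq> U" by blast
    with U show "\<exists>r>0. {y \<in> closure \<Omega>. L_f \<Omega> f x y < r} \<subseteq> \<Union>\<K>" by blast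
  qed
  ultimately have "istopology ?P" unfolding istopology_def by blast
  then show ?thesis unfolding L_topology_def by (simp add: topology_inverse')
qed

text \<open>The filter of points \<open>y \<in> S\<close> with \<open>L_f(x,y) \<longrightarrow> 0\<close>.\<close>

definition L_to0 :: "'a::metric_space set \<Rightarrow> ('a \<Rightarrow> real) \<Rightarrow> 'a \<Rightarrow> 'a set \<Rightarrow> 'a filter" where
  "L_to0 \<Omega> f x S = inf (filtercomap (\<lambda>y. L_f \<Omega> f x y) (nhds 0)) (principal S)"

definition USC_L :: "'a::metric_space set \<Rightarrow> ('a \<Rightarrow> real) \<Rightarrow> ('a \<Rightarrow> real) \<Rightarrow> bool" where
  "USC_L \<Omega> f u \<longleftrightarrow>
     (\<forall>x\<in>closure \<Omega>. Limsup (L_to0 \<Omega> f x (closure \<Omega>)) (\<lambda>y. ereal (u y)) \<le> ereal (u x))"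

definition LSC_L :: "'a::metric_space set \<Rightarrow> ('a \<Rightarrow> real) \<Rightarrow> ('a \<Rightarrow> real) \<Rightarrow> bool" where
  "LSC_L \<Omega> f u \<longleftrightarrow>
     (\<forall>x\<in>closure \<Omega>. Liminf (L_to0 \<Omega> f x (closure \<Omega>)) (\<lambda>y. ereal (u y)) \<ge> ereal (u x))"

definition L_locally_bounded ::
  "'a::metric_space set \<Rightarrow> ('a \<Rightarrow> real) \<Rightarrow> ('a \<Rightarrow> real) \<Rightarrow> bool" where
  "L_locally_bounded \<Omega> f u \<longleftrightarrow>
     (\<forall>x\<in>\<Omega>. \<exists>r>0. bounded (u ` {y\<in>\<Omega>. L_f \<Omega> f x y < r}))"

text \<open>The difference quotient is undefined at \<open>x = x0\<close>, so \<open>x0\<close> is removed from the upper limit.\<close>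

definition monge_slope ::
  "'a::metric_space set \<Rightarrow> ('a \<Rightarrow> real) \<Rightarrow> ('a \<Rightarrow> real) \<Rightarrow> 'a \<Rightarrow> ereal" where
  "monge_slope \<Omega> f u x0 =
     Limsup (L_to0 \<Omega> f x0 (\<Omega> - {x0})) (\<lambda>x. ereal ((u x0 - u x) / L_f \<Omega> f x0 x))"

definition monge_subsolution ::
  "'a::metric_space set \<Rightarrow> ('a \<Rightarrow> real) \<Rightarrow> ('a \<Rightarrow> real) \<Rightarrow> bool" where
  "monge_subsolution \<Omega> f u \<longleftrightarrow>
     L_locally_bounded \<Omega> f u \<and> (\<forall>x0\<in>\<Omega>. monge_slope \<Omega> f u x0 \<le> 1)"

definition monge_supersolution ::
  "'a::metric_space set \<Rightarrow> ('a \<Rightarrow> real) \<Rightarrow> ('a \<Rightarrow> real) \<Rightarrow> bool" where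
  "monge_supersolution \<Omega> f u \<longleftrightarrow>
     L_locally_bounded \<Omega> f u \<and> (\<forall>x0\<in>\<Omega>. monge_slope \<Omega> f u x0 \<ge> 1)"

end

theory Submission
  imports Defs
begin

text \<open>If \<open>u\<close> exceeded \<open>v\<close> somewhere, then after subtracting from both a constant \<open>m < inf u\<close> one
  could shrink \<open>u - m\<close> by a factor \<open>c < 1\<close> such that \<open>w = c (u - m) - (v - m)\<close> is still positive
  somewhere; since \<open>u - m \<ge> 0\<close>, the shrinking keeps \<open>w \<le> 0\<close> on the boundary. As \<open>w\<close> is upper
  semicontinuous for \<open>L_f\<close>, compactness gives a maximum point \<open>x0\<close>, which has to lie in \<open>\<Omega>\<close>.
  Maximality says \<open>v x0 - v x \<le> c (u x0 - u x)\<close> for all \<open>x\<close>. Division by \<open>L_f x0 x\<close> makes the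
  Monge slope of \<open>v\<close> at \<open>x0\<close> at most \<open>c\<close> times that of \<open>u\<close>, so that \<open>1 \<le> c\<close>, which is absurd.

  A maximum over a single variable is enough here because both Monge conditions concern the upper
  limit of the same difference quotient, so the two functions can be compared at one point.\<close>

lemma L_f_nonneg: "0 \<le> L_f \<Omega> f x y"
  by (simp add: L_f_def)

lemma eventually_L_to0:
  "eventually P (L_to0 \<Omega> f x S) \<longleftrightarrow> (\<exists>r>0. \<forall>y\<in>S. L_f \<Omega> f x y < r \<longrightarrow> P y)"
proof -
  have "eventually P (L_to0 \<Omega> f x S) \<longleftrightarrow>
      (\<exists>Q. eventually Q (nhds (0::real)) \<and> (\<forall>y. Q (L_f \<Omega> f x y) \<longrightarrow> y \<in> S \<longrightarrow> P y))"
    by (simp add: L_to0_def eventually_inf_principal eventually_filtercomap)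
  also have "\<dots> \<longleftrightarrow> (\<exists>r>0. \<forall>y\<in>S. L_f \<Omega> f x y < r \<longrightarrow> P y)"
  proof
    assume "\<exists>Q. eventually Q (nhds (0::real)) \<and> (\<forall>y. Q (L_f \<Omega> f x y) \<longrightarrow> y \<in> S \<longrightarrow> P y)"
    then obtain Q r where Q: "\<forall>y. Q (L_f \<Omega> f x y) \<longrightarrow> y \<in> S \<longrightarrow> P y"
      and r: "r > 0" "\<And>t. dist t (0::real) < r \<Longrightarrow> Q t"
      by (auto simp: eventually_nhds_metric)
    then show "\<exists>r>0. \<forall>y\<in>S. L_f \<Omega> f x y < r \<longrightarrow> P y"
      by (intro exI[of _ r]) (simp add: L_f_nonneg)
  next
    assume "\<exists>r>0. \<forall>y\<in>S. L_f \<Omega> f x y < r \<longrightarrow> P y"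
    then obtain r where r: "r > 0" "\<forall>y\<in>S. L_f \<Omega> f x y < r \<longrightarrow> P y" by blast
    have "eventually (\<lambda>t. t < r) (nhds (0::real))"
      using r(1) by (intro eventually_nhds_in_open[of "{..<r}", simplified])
    with r(2) show
      "\<exists>Q. eventually Q (nhds (0::real)) \<and> (\<forall>y. Q (L_f \<Omega> f x y) \<longrightarrow> y \<in> S \<longrightarrow> P y)"
      by (intro exI[of _ "\<lambda>t. t < r"]) auto
  qed
  finally show ?thesis .
qed

lemma topspace_L_topology: "topspace (L_topology \<Omega> f) = closure \<Omega>"
proof
  show "topspace (L_topology \<Omega> f) \<subseteq> closure \<Omega>"
    by (auto simp: topspace_def openin_L_topology)
  have "openin (L_topology \<Omega> f) (closure \<Omega>)"
    by (auto simp: openin_L_topology intro!: exI[of _ "1::real"])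
  then show "closure \<Omega> \<subseteq> topspace (L_topology \<Omega> f)"
    by (rule openin_subset)
qed

text \<open>If no maximum were attained, the open sets \<open>{x. w x < w y}\<close> would cover the space, and the
  largest of the finitely many values \<open>w y\<close> of a subcover would be attained at an uncovered
  point.\<close>
lemma compact_space_attains_sup:
  fixes w :: "'a \<Rightarrow> 'b::linorder"
  assumes compact: "compact_space X" and nonempty: "topspace X \<noteq> {}"
    and usc: "\<And>c. openin X {x \<in> topspace X. w x < c}"
  obtains x0 where "x0 \<in> topspace X" "\<And>x. x \<in> topspace X \<Longrightarrow> w x \<le> w x0"
proof (rule ccontr)
  assume "\<not> thesis"
  with that have no_max: "\<exists>y\<in>topspace X. w x < w y" if "x \<in> topspace X" for x
    using \<open>x \<in> topspace X\<close> by (meson not_le)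
  define U where "U y = {x \<in> topspace X. w x < w y}" for y
  have "\<forall>V \<in> U ` topspace X. openin X V" "topspace X \<subseteq> \<Union>(U ` topspace X)"
    using usc no_max by (auto simp: U_def)
  then obtain \<F> where "finite \<F>" "\<F> \<subseteq> U ` topspace X" "topspace X \<subseteq> \<Union>\<F>"
    using compact by (meson compact_space_alt)
  then obtain T where T: "T \<subseteq> topspace X" "finite T" "topspace X \<subseteq> \<Union>(U ` T)"
    by (metis finite_subset_image)
  have "T \<noteq> {}" using T(3) nonempty by auto
  then have "Max (w ` T) \<in> w ` T" using T(2) by simp
  then obtain t where t: "t \<in> T" "w t = Max (w ` T)" by (metis imageE)
  then obtain s where "s \<in> T" "w t < w s" using T by (auto simp: U_def)
  then show False using t T(2) by (simp add: leD)
qed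

lemma USC_L_less:
  assumes "USC_L \<Omega> f u" "x \<in> closure \<Omega>" "u x < c"
  shows "eventually (\<lambda>y. u y < c) (L_to0 \<Omega> f x (closure \<Omega>))"
proof -
  have "Limsup (L_to0 \<Omega> f x (closure \<Omega>)) (\<lambda>y. ereal (u y)) \<le> ereal (u x)"
    using assms unfolding USC_L_def by blast
  also have "ereal (u x) < ereal c" using assms by simp
  finally show ?thesis by (auto dest: Limsup_lessD)
qed

lemma LSC_L_greater:
  assumes "LSC_L \<Omega> f v" "x \<in> closure \<Omega>" "c < v x"
  shows "eventually (\<lambda>y. c < v y) (L_to0 \<Omega> f x (closure \<Omega>))"
proof -
  have "ereal c < ereal (v x)" using assms by simp
  also have "ereal (v x) \<le> Liminf (L_to0 \<Omega> f x (closure \<Omega>)) (\<lambda>y. ereal (v y))"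
    using assms unfolding LSC_L_def by blast
  finally show ?thesis by (auto dest: less_LiminfD)
qed

lemma openin_scaled_difference_less:
  assumes "USC_L \<Omega> f u" "LSC_L \<Omega> f v" "0 < c"
  shows "openin (L_topology \<Omega> f) {x \<in> closure \<Omega>. c * u x - v x < k}"
  unfolding openin_L_topology
proof (intro conjI ballI)
  fix x assume "x \<in> {x \<in> closure \<Omega>. c * u x - v x < k}"
  then have x: "x \<in> closure \<Omega>" and less: "c * u x - v x < k" by auto
  \<comment> \<open>Half of the slack is left to \<open>c * u\<close> and half to \<open>v\<close>.\<close>
  define e where "e = (k - (c * u x - v x)) / 2"
  have "e > 0" using less by (simp add: e_def)
  have "eventually (\<lambda>y. u y < u x + e / c) (L_to0 \<Omega> f x (closure \<Omega>))"
    using assms x \<open>e > 0\<close> by (intro USC_L_less) auto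
  moreover have "eventually (\<lambda>y. v x - e < v y) (L_to0 \<Omega> f x (closure \<Omega>))"
    using assms x \<open>e > 0\<close> by (intro LSC_L_greater) auto
  ultimately have "eventually (\<lambda>y. c * u y - v y < k) (L_to0 \<Omega> f x (closure \<Omega>))"
  proof eventually_elim
    case (elim y)
    have "c * u y < c * (u x + e / c)" using elim assms by simp
    then have "c * u y < c * u x + e" using assms by (simp add: algebra_simps)
    then show ?case using elim unfolding e_def by (simp add: field_simps)
  qed
  then show "\<exists>r>0. {y \<in> closure \<Omega>. L_f \<Omega> f x y < r} \<subseteq> {x \<in> closure \<Omega>. c * u x - v x < k}"
    by (auto simp: eventually_L_to0)
qed auto

text \<open>Moving away from a maximum point of \<open>c * u - v\<close>, the function \<open>v\<close> decreases by at most \<open>c\<close>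
  times as much as \<open>u\<close> does, which is incompatible with a slope of \<open>u\<close> at most \<open>1\<close> and a slope
  of \<open>v\<close> at least \<open>1\<close>.\<close>
lemma no_interior_max_of_scaled_difference:
  assumes u: "monge_subsolution \<Omega> f u" and v: "monge_supersolution \<Omega> f v"
    and c: "0 < c" "c < 1" and x0: "x0 \<in> \<Omega>"
    and max: "\<And>x. x \<in> \<Omega> \<Longrightarrow> c * u x - v x \<le> c * u x0 - v x0"
  shows False
proof -
  let ?F = "L_to0 \<Omega> f x0 (\<Omega> - {x0})"
  let ?q = "\<lambda>u x. (u x0 - u x) / L_f \<Omega> f x0 x"
  obtain b where b: "1 < b" "b < 1 / c"
    using c dense[of 1 "1 / c"] by auto
  have "monge_slope \<Omega> f u x0 \<le> 1"
    using u x0 unfolding monge_subsolution_def by blast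
  also have "1 < ereal b" using b by simp
  finally have "eventually (\<lambda>x. ?q u x < b) ?F"
    unfolding monge_slope_def by (auto dest: Limsup_lessD)
  moreover have "eventually (\<lambda>x. x \<in> \<Omega>) ?F"
    by (auto simp: eventually_L_to0 intro!: exI[of _ "1::real"])
  ultimately have "eventually (\<lambda>x. ereal (?q v x) \<le> ereal (c * b)) ?F"
  proof eventually_elim
    case (elim x)
    have "v x0 - v x \<le> c * (u x0 - u x)"
      using max[OF elim(2)] by (simp add: algebra_simps)
    then have "?q v x \<le> c * (u x0 - u x) / L_f \<Omega> f x0 x"
      by (intro divide_right_mono L_f_nonneg)
    also have "\<dots> = c * ?q u x" by simp
    also have "\<dots> \<le> c * b" using elim(1) c by (intro mult_left_mono) auto
    finally show ?case by simp
  qed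
  then have "monge_slope \<Omega> f v x0 \<le> ereal (c * b)"
    unfolding monge_slope_def by (rule Limsup_bounded)
  moreover have "1 \<le> monge_slope \<Omega> f v x0"
    using v x0 unfolding monge_supersolution_def by blast
  ultimately have "1 \<le> ereal (c * b)" by (rule order_trans[rotated])
  then show False using b c by (simp add: field_simps)
qed

theorem theorem3p6:
  fixes \<Omega> :: "'a::complete_space set"
    and f u v :: "'a \<Rightarrow> real"
  assumes "length_space TYPE('a)"
    and "open \<Omega>" and "connected \<Omega>" and "\<Omega> \<noteq> {}" and "bounded \<Omega>" and "\<Omega> \<noteq> UNIV"
    and "f \<in> borel_measurable (restrict_space borel (closure \<Omega>))"
    and "\<And>x. x \<in> closure \<Omega> \<Longrightarrow> f x > 0"
    and "(INF x\<in>\<Omega>. f x) > 0"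
    and "\<And>x y. x \<in> closure \<Omega> \<Longrightarrow> y \<in> closure \<Omega> \<Longrightarrow> Gamma_f \<Omega> f x y \<noteq> {}"
    and "compact_space (L_topology \<Omega> f)"
    and "USC_L \<Omega> f u" and "bounded (u ` closure \<Omega>)" and "monge_subsolution \<Omega> f u"
    and "LSC_L \<Omega> f v" and "bounded (v ` closure \<Omega>)" and "monge_supersolution \<Omega> f v"
    and "\<And>x. x \<in> frontier \<Omega> \<Longrightarrow> u x \<le> v x"
  shows "\<forall>x\<in>closure \<Omega>. u x \<le> v x"
proof (rule ccontr)
  assume "\<not> (\<forall>x\<in>closure \<Omega>. u x \<le> v x)"
  then obtain z where z: "z \<in> closure \<Omega>" "v z < u z" by (auto simp: not_le)
  obtain B where "\<forall>x\<in>closure \<Omega>. \<bar>u x\<bar> \<le> B"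
    using \<open>bounded (u ` closure \<Omega>)\<close> by (auto simp: bounded_iff)
  then obtain m where m: "\<And>x. x \<in> closure \<Omega> \<Longrightarrow> m < u x"
    using that[of "- B - 1"] by (smt (verit))
  have "max 0 ((v z - m) / (u z - m)) < 1"
    using z m[OF z(1)] by (simp add: field_simps)
  then obtain c where c: "0 < c" "c < 1" "(v z - m) / (u z - m) < c"
    using dense by (metis max_less_iff_conj)
  obtain x0 where x0: "x0 \<in> closure \<Omega>"
    and max: "\<And>x. x \<in> closure \<Omega> \<Longrightarrow> c * u x - v x \<le> c * u x0 - v x0"
    using compact_space_attains_sup[OF \<open>compact_space (L_topology \<Omega> f)\<close>,
        where w = "\<lambda>x. c * u x - v x", unfolded topspace_L_topology]
      openin_scaled_difference_less[OF \<open>USC_L \<Omega> f u\<close> \<open>LSC_L \<Omega> f v\<close> c(1)] z(1)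
    by (metis (no_types, lifting) empty_iff)
  have "v z - m < c * (u z - m)"
    using c(3) m[OF z(1)] by (simp add: field_simps)
  with max[OF z(1)] have pos: "v x0 - m < c * (u x0 - m)"
    by (simp add: algebra_simps)
  also have "c * (u x0 - m) \<le> u x0 - m"
    using c m[OF x0] by (simp add: mult_left_le_one_le)
  finally have "v x0 < u x0" by simp
  then have "x0 \<notin> frontier \<Omega>"
    using assms(18) by (meson not_le)
  then have "x0 \<in> \<Omega>"
    using x0 \<open>open \<Omega>\<close> by (simp add: frontier_def interior_open)
  moreover have "c * u x - v x \<le> c * u x0 - v x0" if "x \<in> \<Omega>" for x
    using max that closure_subset by blast
  ultimately show False
    using no_interior_max_of_scaled_difference[OF \<open>monge_subsolution \<Omega> f u\<close>
        \<open>monge_supersolution \<Omega> f v\<close> c(1,2)] by blast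
qed

end
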